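(* Let $\mathcal{A}$ and $\mathcal{U}$ be Banach algebras such that $\mathcal{U}$ is a Banach $\mathcal{A}$-bimodule with compatible actions and norm. Assume that every derivation $D$ on $\mathcal{A}\ltimes\mathcal{U}$ satisfies $D(\{0\}\times\mathcal{U})\subseteq\{0\}\times\mathcal{U}$. Suppose that $\delta(\mathcal{A})\subseteq ann_{\mathcal{U}}\mathcal{U}$ for every $\delta\in Z^1(\mathcal{A},\mathcal{U})$. If $H^1(\mathcal{A})=(0)$, then there is a linear isomorphism $$H^1(\mathcal{A}\ltimes\mathcal{U})\cong\frac{Z^1(\mathcal{A},\mathcal{U})\times[Hom_{\mathcal{A}}(\mathcal{U})\cap Z^1(\mathcal{U})]}{\mathcal{F}},$$ where $\mathcal{F}$ is the following linear subspace of $Z^1(\mathcal{A},\mathcal{U})\times[Hom_{\mathcal{A}}(\mathcal{U})\cap Z^1(\mathcal{U})]$: $$\mathcal{F}=\{(id_{\mathcal{A},x},\ r_a+id_{\mathcal{U},x})\mid x\in\mathcal{U},\ a\in\mathcal{A},\ id_a=0\}.$$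
   Context: All algebras are over $\mathbb{C}$. "Banach $\mathcal{A}$-bimodule with compatible actions and norm" means: $\|ax\|\le\|a\|\|x\|$, $\|xa\|\le\|x\|\|a\|$, and $a(xy)=(ax)y$, $(xy)a=x(ya)$, $(xa)y=x(ay)$ for all $a\in\mathcal{A}$, $x,y\in\mathcal{U}$. The semidirect product $\mathcal{A}\ltimes\mathcal{U}$ is $\mathcal{A}\times\mathcal{U}$ with multiplication $(a,x)(b,y)=(ab,\,ay+xb+xy)$ and norm $\|(a,x)\|=\|a\|+\|x\|$. For a Banach algebra $\mathcal{B}$ and a Banach $\mathcal{B}$-bimodule $\mathcal{X}$, a derivation $\delta:\mathcal{B}\to\mathcal{X}$ is a linear map with $\delta(bc)=b\delta(c)+\delta(b)c$; inner derivations are the maps $b\mapsto bx-xb$ with $x\in\mathcal{X}$; $Z^1(\mathcal{B},\mathcal{X})$ is the space of continuous derivations, $N^1(\mathcal{B},\mathcal{X})$ the space of inner derivations, $H^1(\mathcal{B},\mathcal{X})=Z^1(\mathcal{B},\mathcal{X})/N^1(\mathcal{B},\mathcal{X})$; write $Z^1(\mathcal{B}),N^1(\mathcal{B}),H^1(\mathcal{B})$ when $\mathcal{X}=\mathcal{B}$. $Hom_{\mathcal{A}}(\mathcal{U})$ is the space of continuous $\mathcal{A}$-bimodule homomorphisms $\mathcal{U}\to\mathcal{U}$. $ann_{\mathcal{U}}\mathcal{U}=\{x\in\mathcal{U}\mid x\mathcal{U}=\mathcal{U}x=(0)\}$. Notation: $id_a(b)=ba-ab$ ($b\in\mathcal{A}$);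 $id_{\mathcal{A},x}:\mathcal{A}\to\mathcal{U}$, $id_{\mathcal{A},x}(b)=bx-xb$; $id_{\mathcal{U},x}:\mathcal{U}\to\mathcal{U}$, $id_{\mathcal{U},x}(y)=yx-xy$; $r_a:\mathcal{U}\to\mathcal{U}$, $r_a(y)=ya-ay$. The symbol $\cong$ denotes isomorphism of linear spaces. *)

theory Defs
  imports "HOL-Analysis.Analysis" "HOL-Library.Function_Algebras"
begin

section \<open>Complex vector spaces, Banach spaces and Banach algebras\<close>

class scaleC =
  fixes scaleC :: "complex \<Rightarrow> 'a \<Rightarrow> 'a"  (infixr "*\<^sub>C" 75)

class complex_vector = scaleC + ab_group_add +
  assumes scaleC_add_right: "c *\<^sub>C (x + y) = c *\<^sub>C x + c *\<^sub>C y"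
    and scaleC_add_left: "(c + d) *\<^sub>C x = c *\<^sub>C x + d *\<^sub>C x"
    and scaleC_scaleC: "c *\<^sub>C (d *\<^sub>C x) = (c * d) *\<^sub>C x"
    and scaleC_one: "1 *\<^sub>C x = x"

lemma vector_space_scaleC: "vector_space (scaleC :: complex \<Rightarrow> 'a \<Rightarrow> 'a::complex_vector)"
  by standard (simp_all add: scaleC_add_right scaleC_add_left scaleC_scaleC scaleC_one)

abbreviation clinear :: "('a::complex_vector \<Rightarrow> 'b::complex_vector) \<Rightarrow> bool"
  where "clinear \<equiv> Vector_Spaces.linear scaleC scaleC"

abbreviation csubspace :: "'a::complex_vector set \<Rightarrow> bool"
  where "csubspace \<equiv> module.subspace scaleC"

class complex_banach = complex_vector + banach +
  assumes scaleR_scaleC: "scaleR r x = complex_of_real r *\<^sub>C x"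
    and norm_scaleC: "norm (c *\<^sub>C x) = cmod c * norm x"

text \<open>Submultiplicativity of the norm, \<open>norm (x * y) \<le> norm x * norm y\<close>, is part of
  \<open>real_normed_algebra\<close>. No unit is assumed.\<close>

class complex_banach_algebra = complex_banach + real_normed_algebra +
  assumes mult_scaleC_left: "(c *\<^sub>C x) * y = c *\<^sub>C (x * y)"
    and mult_scaleC_right: "x * (c *\<^sub>C y) = c *\<^sub>C (x * y)"

instantiation "fun" :: (type, complex_vector) complex_vector
begin

definition scaleC_fun :: "complex \<Rightarrow> ('a \<Rightarrow> 'b) \<Rightarrow> 'a \<Rightarrow> 'b"
  where "scaleC_fun c f = (\<lambda>x. c *\<^sub>C f x)"

instance
  by standard (auto simp: scaleC_fun_def fun_eq_iff scaleC_add_right scaleC_add_left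
      scaleC_scaleC scaleC_one)

end

instantiation prod :: (complex_vector, complex_vector) complex_vector
begin

definition scaleC_prod :: "complex \<Rightarrow> 'a \<times> 'b \<Rightarrow> 'a \<times> 'b"
  where "scaleC_prod c p = (c *\<^sub>C fst p, c *\<^sub>C snd p)"

instance
  by standard (auto simp: scaleC_prod_def prod_eq_iff scaleC_add_right scaleC_add_left
      scaleC_scaleC scaleC_one)

end


section \<open>Quotient spaces\<close>

record 'v cspace =
  vcarrier :: "'v set"
  vzero :: 'v
  vadd :: "'v \<Rightarrow> 'v \<Rightarrow> 'v"
  vscale :: "complex \<Rightarrow> 'v \<Rightarrow> 'v"

definition lcoset :: "'v::complex_vector set \<Rightarrow> 'v \<Rightarrow> 'v set"
  where "lcoset W v = {v + w | w. w \<in> W}"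

text \<open>In the scalar multiplication the subspace \<open>W\<close> is added back, since the pointwise multiple
  \<open>0 *\<^sub>C X\<close> of a coset is \<open>{0}\<close> rather than the coset \<open>W\<close>.\<close>

definition quotient_space :: "'v::complex_vector set \<Rightarrow> 'v set \<Rightarrow> 'v set cspace"
  where "quotient_space V W =
    \<lparr> vcarrier = lcoset W ` V,
      vzero = W,
      vadd = (\<lambda>X Y. {x + y | x y. x \<in> X \<and> y \<in> Y}),
      vscale = (\<lambda>c X. {c *\<^sub>C x + w | x w. x \<in> X \<and> w \<in> W}) \<rparr>"

lemma quotient_space_add:
  assumes "csubspace W"
  shows "vadd (quotient_space V W) (lcoset W v) (lcoset W v') = lcoset W (v + v')"
    (is "?L = ?R")
proof -
  interpret vector_space "scaleC :: complex \<Rightarrow> 'a \<Rightarrow> 'a" by (rule vector_space_scaleC)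
  have L: "?L = {x + y | x y. x \<in> lcoset W v \<and> y \<in> lcoset W v'}"
    by (simp add: quotient_space_def)
  show ?thesis
  proof (intro subset_antisym subsetI)
    fix z assume "z \<in> ?L"
    then obtain w1 w2 where "w1 \<in> W" "w2 \<in> W" "z = (v + w1) + (v' + w2)"
      unfolding L unfolding lcoset_def by auto
    then have "w1 + w2 \<in> W" "z = (v + v') + (w1 + w2)"
      by (simp_all add: subspace_add[OF assms] add_ac)
    then show "z \<in> ?R" unfolding lcoset_def by blast
  next
    fix z assume "z \<in> ?R"
    then obtain w where w: "w \<in> W" "z = (v + v') + w" unfolding lcoset_def by auto
    have "v + w \<in> lcoset W v" using w unfolding lcoset_def by blast
    moreover have "v' + 0 \<in> lcoset W v'" using subspace_0[OF assms] unfolding lcoset_def by blast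
    moreover have "z = (v + w) + (v' + 0)" using w by (simp add: add_ac)
    ultimately show "z \<in> ?L" unfolding L by blast
  qed
qed

lemma quotient_space_scale:
  assumes "csubspace W"
  shows "vscale (quotient_space V W) c (lcoset W v) = lcoset W (c *\<^sub>C v)" (is "?L = ?R")
proof -
  interpret vector_space "scaleC :: complex \<Rightarrow> 'a \<Rightarrow> 'a" by (rule vector_space_scaleC)
  have L: "?L = {c *\<^sub>C x + w | x w. x \<in> lcoset W v \<and> w \<in> W}"
    by (simp add: quotient_space_def)
  show ?thesis
  proof (intro subset_antisym subsetI)
    fix z assume "z \<in> ?L"
    then obtain w1 w2 where "w1 \<in> W" "w2 \<in> W" "z = c *\<^sub>C (v + w1) + w2"
      unfolding L unfolding lcoset_def by auto
    then have "c *\<^sub>C w1 + w2 \<in> W" "z = c *\<^sub>C v + (c *\<^sub>C w1 + w2)"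
      using subspace_add[OF assms] subspace_scale[OF assms]
      by (auto simp only: scaleC_add_right add.assoc)
    then show "z \<in> ?R" unfolding lcoset_def by blast
  next
    fix z assume "z \<in> ?R"
    then obtain w where w: "w \<in> W" "z = c *\<^sub>C v + w" unfolding lcoset_def by auto
    have "v + 0 \<in> lcoset W v" using subspace_0[OF assms] unfolding lcoset_def by blast
    then have "v \<in> lcoset W v" by simp
    then show "z \<in> ?L" unfolding L using w by blast
  qed
qed

definition linear_iso :: "'v cspace \<Rightarrow> 'w cspace \<Rightarrow> bool"  (infix "\<cong>\<^sub>C" 50)
  where "S \<cong>\<^sub>C T \<longleftrightarrow> (\<exists>\<phi>. bij_betw \<phi> (vcarrier S) (vcarrier T) \<and>
    (\<forall>X\<in>vcarrier S. \<forall>Y\<in>vcarrier S. \<phi> (vadd S X Y) = vadd T (\<phi> X) (\<phi> Y)) \<and>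
    (\<forall>c. \<forall>X\<in>vcarrier S. \<phi> (vscale S c X) = vscale T c (\<phi> X)))"


section \<open>Derivations and first cohomology\<close>

text \<open>The multiplication \<open>m\<close> of the algebra and the two actions \<open>l b x\<close> (\<open>b\<close> acting on \<open>x\<close> from
  the left) and \<open>r x b\<close> (from the right) are explicit parameters, because the multiplication of a
  semidirect product depends on the module actions and hence is not determined by its type. An
  algebra with multiplication \<open>m\<close>, as a bimodule over itself, has \<open>l = r = m\<close>.\<close>

definition derivation ::
  "('b \<Rightarrow> 'b \<Rightarrow> 'b) \<Rightarrow> ('b \<Rightarrow> 'x \<Rightarrow> 'x) \<Rightarrow> ('x \<Rightarrow> 'b \<Rightarrow> 'x) \<Rightarrow>
    ('b::complex_banach \<Rightarrow> 'x::complex_banach) \<Rightarrow> bool"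
  where "derivation m l r \<delta> \<longleftrightarrow>
    clinear \<delta> \<and> (\<forall>b c. \<delta> (m b c) = l b (\<delta> c) + r (\<delta> b) c)"

definition inner_der ::
  "('b \<Rightarrow> 'x \<Rightarrow> 'x) \<Rightarrow> ('x \<Rightarrow> 'b \<Rightarrow> 'x) \<Rightarrow> 'x \<Rightarrow> 'b::complex_banach \<Rightarrow> 'x::complex_banach"
  where "inner_der l r x = (\<lambda>b. l b x - r x b)"

definition Z1 ::
  "('b \<Rightarrow> 'b \<Rightarrow> 'b) \<Rightarrow> ('b \<Rightarrow> 'x \<Rightarrow> 'x) \<Rightarrow> ('x \<Rightarrow> 'b \<Rightarrow> 'x) \<Rightarrow>
    ('b::complex_banach \<Rightarrow> 'x::complex_banach) set"
  where "Z1 m l r = {\<delta>. derivation m l r \<delta> \<and> continuous_on UNIV \<delta>}"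

definition N1 ::
  "('b \<Rightarrow> 'x \<Rightarrow> 'x) \<Rightarrow> ('x \<Rightarrow> 'b \<Rightarrow> 'x) \<Rightarrow> ('b::complex_banach \<Rightarrow> 'x::complex_banach) set"
  where "N1 l r = range (inner_der l r)"

definition H1 ::
  "('b \<Rightarrow> 'b \<Rightarrow> 'b) \<Rightarrow> ('b \<Rightarrow> 'x \<Rightarrow> 'x) \<Rightarrow> ('x \<Rightarrow> 'b \<Rightarrow> 'x) \<Rightarrow>
    ('b::complex_banach \<Rightarrow> 'x::complex_banach) set cspace"
  where "H1 m l r = quotient_space (Z1 m l r) (N1 l r)"

definition ann :: "'u::complex_banach_algebra set"
  where "ann = {x. \<forall>y. x * y = 0 \<and> y * x = 0}"


section \<open>Banach bimodules with compatible actions and norm\<close>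

locale compatible_banach_bimodule =
  fixes lact :: "'a::complex_banach_algebra \<Rightarrow> 'u::complex_banach_algebra \<Rightarrow> 'u"
    and ract :: "'u \<Rightarrow> 'a \<Rightarrow> 'u"
  assumes clinear_lact_left: "clinear (\<lambda>a. lact a x)"
    and clinear_lact_right: "clinear (\<lambda>x. lact a x)"
    and clinear_ract_left: "clinear (\<lambda>x. ract x a)"
    and clinear_ract_right: "clinear (\<lambda>a. ract x a)"
    and lact_mult: "lact (a * b) x = lact a (lact b x)"
    and ract_mult: "ract x (a * b) = ract (ract x a) b"
    and lact_ract: "ract (lact a x) b = lact a (ract x b)"
    and norm_lact: "norm (lact a x) \<le> norm a * norm x"
    and norm_ract: "norm (ract x a) \<le> norm x * norm a"
    and lact_times: "lact a (x * y) = lact a x * y"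
    and ract_times: "ract (x * y) a = x * ract y a"
    and ract_times_lact: "ract x a * y = x * lact a y"

definition bimodule_hom ::
  "('a \<Rightarrow> 'u \<Rightarrow> 'u) \<Rightarrow> ('u \<Rightarrow> 'a \<Rightarrow> 'u) \<Rightarrow> ('u::complex_banach \<Rightarrow> 'u) set"
  where "bimodule_hom lact ract =
    {f. clinear f \<and> continuous_on UNIV f \<and>
        (\<forall>a x. f (lact a x) = lact a (f x)) \<and> (\<forall>x a. f (ract x a) = ract (f x) a)}"


section \<open>Semidirect products\<close>

text \<open>A copy of the product type: the library norm on \<open>'a \<times> 'u\<close> is the Euclidean one, whereas the
  semidirect product carries the norm \<open>norm a + norm x\<close>.\<close>

datatype ('a, 'u) semidirect = SD (sd_fst: 'a) (sd_snd: 'u)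

instantiation semidirect :: (complex_vector, complex_vector) complex_vector
begin

definition "0 = SD 0 0"
definition "p + q = SD (sd_fst p + sd_fst q) (sd_snd p + sd_snd q)"
definition "p - q = SD (sd_fst p - sd_fst q) (sd_snd p - sd_snd q)"
definition "- p = SD (- sd_fst p) (- sd_snd p)"
definition "c *\<^sub>C p = SD (c *\<^sub>C sd_fst p) (c *\<^sub>C sd_snd p)"

instance
  by standard (auto simp: zero_semidirect_def plus_semidirect_def minus_semidirect_def
      uminus_semidirect_def scaleC_semidirect_def add_ac
      scaleC_add_right scaleC_add_left scaleC_scaleC scaleC_one)

end

instantiation semidirect :: (complex_banach, complex_banach) real_normed_vector
begin

definition "scaleR c p = SD (scaleR c (sd_fst p)) (scaleR c (sd_snd p))"
definition "norm p = norm (sd_fst p) + norm (sd_snd p)"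
definition "dist (p :: ('a, 'b) semidirect) q = norm (p - q)"
definition "sgn (p :: ('a, 'b) semidirect) = scaleR (inverse (norm p)) p"
definition "(uniformity :: (('a, 'b) semidirect \<times> ('a, 'b) semidirect) filter) =
  (INF e\<in>{0 <..}. principal {(x, y). dist x y < e})"
definition "open (S :: ('a, 'b) semidirect set) \<longleftrightarrow>
  (\<forall>x\<in>S. \<forall>\<^sub>F (x', y) in uniformity. x' = x \<longrightarrow> y \<in> S)"

instance
proof
  fix x y :: "('a, 'b) semidirect" and a b :: real
  show "scaleR a (x + y) = scaleR a x + scaleR a y"
    by (simp add: scaleR_semidirect_def plus_semidirect_def scaleR_add_right)
  show "scaleR (a + b) x = scaleR a x + scaleR b x"
    by (simp add: scaleR_semidirect_def plus_semidirect_def scaleR_add_left)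
  show "scaleR a (scaleR b x) = scaleR (a * b) x" "scaleR 1 x = x"
    by (simp_all add: scaleR_semidirect_def)
  show "norm x = 0 \<longleftrightarrow> x = 0"
    by (cases x) (simp add: norm_semidirect_def zero_semidirect_def add_nonneg_eq_0_iff)
  show "norm (x + y) \<le> norm x + norm y"
    using norm_triangle_ineq[of "sd_fst x" "sd_fst y"] norm_triangle_ineq[of "sd_snd x" "sd_snd y"]
    by (simp add: norm_semidirect_def plus_semidirect_def)
  show "norm (scaleR a x) = \<bar>a\<bar> * norm x"
    by (simp add: norm_semidirect_def scaleR_semidirect_def distrib_left)
qed (rule dist_semidirect_def sgn_semidirect_def uniformity_semidirect_def open_semidirect_def)+

end

instance semidirect :: (complex_banach, complex_banach) complex_banach
proof
  fix x :: "('a, 'b) semidirect" and r c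
  show "scaleR r x = complex_of_real r *\<^sub>C x"
    by (simp add: scaleR_semidirect_def scaleC_semidirect_def scaleR_scaleC)
  show "norm (c *\<^sub>C x) = cmod c * norm x"
    by (simp add: norm_semidirect_def scaleC_semidirect_def norm_scaleC distrib_left)
next
  fix X :: "nat \<Rightarrow> ('a, 'b) semidirect"
  assume X: "Cauchy X"
  have "Cauchy (\<lambda>n. sd_fst (X n))" "Cauchy (\<lambda>n. sd_snd (X n))"
    unfolding Cauchy_def dist_norm
  proof safe
    fix e :: real assume "e > 0"
    then obtain M where M: "\<And>m n. m \<ge> M \<Longrightarrow> n \<ge> M \<Longrightarrow> norm (X m - X n) < e"
      using X unfolding Cauchy_def dist_norm by blast
    have "norm (sd_fst (X m) - sd_fst (X n)) \<le> norm (X m - X n)"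
      "norm (sd_snd (X m) - sd_snd (X n)) \<le> norm (X m - X n)" for m n
      by (simp_all add: norm_semidirect_def minus_semidirect_def)
    with M show "\<exists>M. \<forall>m\<ge>M. \<forall>n\<ge>M. norm (sd_fst (X m) - sd_fst (X n)) < e"
      "\<exists>M. \<forall>m\<ge>M. \<forall>n\<ge>M. norm (sd_snd (X m) - sd_snd (X n)) < e"
      by (meson le_less_trans)+
  qed
  then obtain a u where "(\<lambda>n. sd_fst (X n)) \<longlonglongrightarrow> a" "(\<lambda>n. sd_snd (X n)) \<longlonglongrightarrow> u"
    by (metis Cauchy_convergent convergent_def)
  then have "(\<lambda>n. norm (sd_fst (X n) - a) + norm (sd_snd (X n) - u)) \<longlonglongrightarrow> 0 + 0"
    by (intro tendsto_add) (simp_all add: LIM_zero tendsto_norm_zero)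
  then have "(\<lambda>n. norm (X n - SD a u)) \<longlonglongrightarrow> 0"
    by (simp add: norm_semidirect_def minus_semidirect_def)
  then have "X \<longlonglongrightarrow> SD a u"
    by (rule LIM_zero_cancel[OF tendsto_norm_zero_cancel])
  then show "convergent X"
    by (rule convergentI)
qed

definition sd_mult ::
  "('a \<Rightarrow> 'u \<Rightarrow> 'u) \<Rightarrow> ('u \<Rightarrow> 'a \<Rightarrow> 'u) \<Rightarrow>
    ('a::complex_banach_algebra, 'u::complex_banach_algebra) semidirect \<Rightarrow>
    ('a, 'u) semidirect \<Rightarrow> ('a, 'u) semidirect"
  where "sd_mult lact ract p q =
    SD (sd_fst p * sd_fst q)
       (lact (sd_fst p) (sd_snd q) + ract (sd_snd p) (sd_fst q) + sd_snd p * sd_snd q)"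

text \<open>For \<open>inner_der (*) (*) a = 0\<close> the parameter \<open>a\<close> is a central element of the algebra;
  \<open>\<lambda>y. ract y a - lact a y\<close> is the map \<open>r\<^sub>a\<close>. Sum and zero of functions are pointwise.\<close>

definition F_space ::
  "('a::complex_banach_algebra \<Rightarrow> 'u::complex_banach_algebra \<Rightarrow> 'u) \<Rightarrow> ('u \<Rightarrow> 'a \<Rightarrow> 'u) \<Rightarrow>
    (('a \<Rightarrow> 'u) \<times> ('u \<Rightarrow> 'u)) set"
  where "F_space lact ract =
    {(inner_der lact ract x, (\<lambda>y. ract y a - lact a y) + inner_der (*) (*) x) | x a.
       inner_der (*) (*) a = 0}"

end

theory Submission
  imports Defs
begin

text \<open>
  Write a bounded derivation \<open>D\<close> of the semidirect product in components. Since \<open>D\<close> preserves the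
  ideal \<open>{0} \<times> U\<close>, it has the form \<open>D (b, y) = (d b, \<delta> b + \<tau> y)\<close>, where \<open>d\<close> is a bounded derivation of
  \<open>A\<close>. As \<open>H\<^sup>1(A) = 0\<close>, \<open>d\<close> is the inner derivation given by some \<open>a\<close>, and subtracting from \<open>D\<close> the
  inner derivation given by \<open>(a, 0)\<close> removes \<open>d\<close>. So modulo inner derivations every \<open>D\<close> has the form
  \<open>T (\<delta>, \<tau>) = (\<lambda>(b, y). (0, \<delta> b + \<tau> y))\<close>, with values in the ideal \<open>{0} \<times> U\<close>; this \<open>T\<close>
  is \<open>into_ideal\<close>.

  The map \<open>T\<close> is linear in the pair \<open>(\<delta>, \<tau>)\<close>, and among the pairs of linear maps the numerator and
  \<open>F\<close> consist of the preimages of the bounded and of the inner derivations. On the one hand,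
  \<open>T (\<delta>, \<tau>)\<close> is a derivation if and only if \<open>\<delta>\<close> and \<open>\<tau>\<close> are derivations,
  \<open>\<tau> (b y) = b \<tau> y + (\<delta> b) y\<close> and \<open>\<tau> (y b) = (\<tau> y) b + y (\<delta> b)\<close>; the terms with \<open>\<delta> b\<close> vanish
  because bounded derivations from \<open>A\<close> to \<open>U\<close> take values in the annihilator, and what remains says
  that \<open>\<tau>\<close> is a bimodule homomorphism. On the other hand, the inner derivation given by \<open>(a, x)\<close> is
  \<open>(b, y) \<mapsto> (b a - a b, (b x - x b) + (y a - a y) + (y x - x y))\<close>, and it has the form
  \<open>T (\<delta>, \<tau>)\<close> exactly when \<open>a\<close> is central; the pairs of linear maps obtained in this way are those
  in \<open>F\<close>.

  The theorem is then the homomorphism theorem for \<open>T\<close> (\<open>quotient_space_iso_vimage\<close>), with the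
  inputs \<open>into_ideal_in_Z1_iff\<close>, \<open>into_ideal_vimage_N1\<close> and \<open>Z1_eq_into_ideal_mod_N1\<close>. That \<open>F\<close> is
  a subspace contained in the numerator also follows from these descriptions as preimages, since
  the inner derivations form a subspace of the bounded derivations.
\<close>

section \<open>Complex-linear maps and quotients\<close>

lemma clinear_iff:
  "clinear f \<longleftrightarrow> (\<forall>x y. f (x + y) = f x + f y) \<and> (\<forall>c x. f (c *\<^sub>C x) = c *\<^sub>C f x)"
  by (simp add: Vector_Spaces.linear_iff vector_space_scaleC)

lemma csubspace_iff:
  "csubspace S \<longleftrightarrow> 0 \<in> S \<and> (\<forall>x\<in>S. \<forall>y\<in>S. x + y \<in> S) \<and> (\<forall>c. \<forall>x\<in>S. c *\<^sub>C x \<in> S)"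
proof -
  interpret vector_space "scaleC :: complex \<Rightarrow> 'a \<Rightarrow> 'a" by (rule vector_space_scaleC)
  show ?thesis by (simp add: subspace_def)
qed

lemma scaleC_minus_one: "(-1) *\<^sub>C x = - (x :: 'v::complex_vector)"
proof -
  interpret vector_space "scaleC :: complex \<Rightarrow> 'v \<Rightarrow> 'v" by (rule vector_space_scaleC)
  show ?thesis by simp
qed

lemma scaleC_diff: "c *\<^sub>C (x - y) = c *\<^sub>C x - c *\<^sub>C (y :: 'v::complex_vector)"
proof -
  interpret vector_space "scaleC :: complex \<Rightarrow> 'v \<Rightarrow> 'v" by (rule vector_space_scaleC)
  show ?thesis by (rule scale_right_diff_distrib)
qed

lemma scaleC_zero: "c *\<^sub>C 0 = (0 :: 'v::complex_vector)"
proof -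
  interpret vector_space "scaleC :: complex \<Rightarrow> 'v \<Rightarrow> 'v" by (rule vector_space_scaleC)
  show ?thesis by simp
qed

lemma clinear_diff: "clinear f \<Longrightarrow> f (x - y) = f x - f y"
  unfolding clinear_iff by (metis add_diff_cancel diff_add_cancel)

lemma clinear_zero: "clinear f \<Longrightarrow> f 0 = 0"
  by (metis clinear_diff diff_self)

lemma csubspace_diff: "csubspace S \<Longrightarrow> x \<in> S \<Longrightarrow> y \<in> S \<Longrightarrow> x - y \<in> S"
  unfolding csubspace_iff by (metis scaleC_minus_one diff_conv_add_uminus)

lemma csubspace_vimage:
  assumes "clinear T" "csubspace N"
  shows "csubspace (T -` N)"
  using assms by (auto simp: csubspace_iff clinear_zero[OF assms(1)]) (auto simp: clinear_iff)

lemma csubspace_range: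
  assumes "clinear T"
  shows "csubspace (range T)"
  using assms clinear_zero[OF assms] unfolding csubspace_iff clinear_iff
  by (auto simp: image_iff) metis+

lemma mem_lcoset_iff: "x \<in> lcoset W v \<longleftrightarrow> x - v \<in> W"
  unfolding lcoset_def by (auto intro: exI[of _ "x - v"])

lemma lcoset_eq_iff:
  assumes "csubspace W"
  shows "lcoset W v = lcoset W v' \<longleftrightarrow> v - v' \<in> W"
proof
  assume "lcoset W v = lcoset W v'"
  moreover have "v \<in> lcoset W v"
    using assms by (simp add: mem_lcoset_iff csubspace_iff)
  ultimately show "v - v' \<in> W" by (simp add: mem_lcoset_iff)
next
  assume v: "v - v' \<in> W"
  have "x - v \<in> W \<longleftrightarrow> x - v' \<in> W" for x
  proof
    assume "x - v \<in> W"
    then have "(x - v) + (v - v') \<in> W" using v assms unfolding csubspace_iff by blast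
    then show "x - v' \<in> W" by simp
  next
    assume "x - v' \<in> W"
    then have "(x - v') - (v - v') \<in> W" using v by (rule csubspace_diff[OF assms])
    then show "x - v \<in> W" by simp
  qed
  then show "lcoset W v = lcoset W v'" by (auto simp: mem_lcoset_iff)
qed

lemma csubspace_Int: "csubspace S \<Longrightarrow> csubspace S' \<Longrightarrow> csubspace (S \<inter> S')"
  by (simp add: csubspace_iff)

lemma vimage_lcoset:
  assumes T: "clinear T" and V: "csubspace V" and N: "csubspace N"
    and v: "v \<in> V" "T v - z \<in> N"
  shows "V \<inter> T -` lcoset N z = lcoset (V \<inter> T -` N) v"
proof -
  have "lcoset N z = lcoset N (T v)"
    using lcoset_eq_iff[OF N] v(2) by blast
  moreover have "x \<in> V \<longleftrightarrow> x - v \<in> V" for x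
    using csubspace_diff[OF V _ v(1)] V v(1) unfolding csubspace_iff by (metis diff_add_cancel)
  ultimately show ?thesis
    by (auto simp: mem_lcoset_iff clinear_diff[OF T])
qed

text \<open>The homomorphism theorem in preimage form. The isomorphism is \<open>X \<mapsto> V \<inter> T -` X\<close>: it sends the
  coset of \<open>z\<close> to the coset of any \<open>v\<close> in \<open>V\<close> with \<open>T v\<close> congruent to \<open>z\<close> modulo \<open>N\<close>, so no
  representatives have to be chosen to define it.\<close>

lemma quotient_space_iso_vimage:
  assumes T: "clinear T" and V: "csubspace V" and N: "csubspace N"
    and into: "\<And>v. v \<in> V \<Longrightarrow> T v \<in> Z"
    and onto: "\<And>z. z \<in> Z \<Longrightarrow> \<exists>v\<in>V. T v - z \<in> N"
  shows "quotient_space Z N \<cong>\<^sub>C quotient_space V (V \<inter> T -` N)"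
proof -
  define F where "F = V \<inter> T -` N"
  define \<phi> where "\<phi> X = V \<inter> T -` X" for X
  have F: "csubspace F" unfolding F_def by (intro csubspace_Int csubspace_vimage T V N)
  have \<phi>: "\<phi> (lcoset N z) = lcoset F v" if "v \<in> V" "T v - z \<in> N" for v z
    unfolding F_def \<phi>_def by (rule vimage_lcoset[OF T V N that])
  have carriers: "vcarrier (quotient_space Z N) = lcoset N ` Z"
    "vcarrier (quotient_space V F) = lcoset F ` V"
    by (simp_all add: quotient_space_def)
  have inj: "inj_on \<phi> (lcoset N ` Z)"
  proof (rule inj_onI)
    fix X Y assume "X \<in> lcoset N ` Z" "Y \<in> lcoset N ` Z" and eq: "\<phi> X = \<phi> Y"
    then obtain z z' where z: "z \<in> Z" "X = lcoset N z" and z': "z' \<in> Z" "Y = lcoset N z'"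
      by blast
    obtain v v' where v: "v \<in> V" "T v - z \<in> N" and v': "v' \<in> V" "T v' - z' \<in> N"
      using onto z(1) z'(1) by meson
    have "lcoset F v = lcoset F v'" using eq z z' \<phi>[OF v] \<phi>[OF v'] by simp
    then have "v - v' \<in> F" by (simp add: lcoset_eq_iff[OF F])
    then have "T v - T v' \<in> N" by (simp add: F_def clinear_diff[OF T])
    then have "lcoset N (T v) = lcoset N (T v')" by (simp add: lcoset_eq_iff[OF N])
    moreover have "lcoset N (T v) = X" "lcoset N (T v') = Y"
      using v(2) v'(2) z(2) z'(2) lcoset_eq_iff[OF N] by blast+
    ultimately show "X = Y" by simp
  qed
  have "\<phi> ` lcoset N ` Z = lcoset F ` V"
  proof (intro subset_antisym subsetI)
    fix Y assume "Y \<in> \<phi> ` lcoset N ` Z"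
    then obtain z where z: "z \<in> Z" "Y = \<phi> (lcoset N z)" by blast
    obtain v where "v \<in> V" "T v - z \<in> N" using onto z(1) by blast
    then show "Y \<in> lcoset F ` V" using \<phi> z by blast
  next
    fix Y assume "Y \<in> lcoset F ` V"
    then obtain v where v: "v \<in> V" "Y = lcoset F v" by blast
    have "T v - T v \<in> N" using N by (simp add: csubspace_iff)
    then have "Y = \<phi> (lcoset N (T v))" using \<phi> v by blast
    then show "Y \<in> \<phi> ` lcoset N ` Z" using into v(1) by blast
  qed
  with inj have bij: "bij_betw \<phi> (lcoset N ` Z) (lcoset F ` V)"
    by (simp add: bij_betw_def)
  have add: "\<phi> (vadd (quotient_space Z N) (lcoset N z) (lcoset N z')) =
      vadd (quotient_space V F) (\<phi> (lcoset N z)) (\<phi> (lcoset N z'))"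
    if zz': "z \<in> Z" "z' \<in> Z" for z z'
  proof -
    obtain v v' where v: "v \<in> V" "T v - z \<in> N" and v': "v' \<in> V" "T v' - z' \<in> N"
      using onto zz' by meson
    then have "(T v - z) + (T v' - z') \<in> N" using N by (simp add: csubspace_iff)
    then have "T (v + v') - (z + z') \<in> N" using T by (simp add: clinear_iff algebra_simps)
    moreover have "v + v' \<in> V" using V v v' by (simp add: csubspace_iff)
    ultimately have "\<phi> (lcoset N (z + z')) = lcoset F (v + v')" by (intro \<phi>)
    then show ?thesis
      by (simp add: quotient_space_add[OF N] quotient_space_add[OF F] \<phi>[OF v] \<phi>[OF v'])
  qed
  have scale: "\<phi> (vscale (quotient_space Z N) c (lcoset N z)) =
      vscale (quotient_space V F) c (\<phi> (lcoset N z))" if z: "z \<in> Z" for c z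
  proof -
    obtain v where v: "v \<in> V" "T v - z \<in> N" using onto z by blast
    then have "c *\<^sub>C (T v - z) \<in> N" using N by (simp add: csubspace_iff)
    then have "T (c *\<^sub>C v) - c *\<^sub>C z \<in> N" using T by (simp add: clinear_iff scaleC_diff)
    moreover have "c *\<^sub>C v \<in> V" using V v by (simp add: csubspace_iff)
    ultimately have "\<phi> (lcoset N (c *\<^sub>C z)) = lcoset F (c *\<^sub>C v)" by (intro \<phi>)
    then show ?thesis
      by (simp add: quotient_space_scale[OF N] quotient_space_scale[OF F] \<phi>[OF v])
  qed
  have "quotient_space Z N \<cong>\<^sub>C quotient_space V F"
    unfolding linear_iso_def carriers using bij add scale by blast
  then show ?thesis unfolding F_def .
qed

lemma quotient_space_trivialD:
  assumes "vcarrier (quotient_space V W) = {vzero (quotient_space V W)}" "csubspace W" "v \<in> V"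
  shows "v \<in> W"
proof -
  have "lcoset W v = W" using assms(1,3) by (auto simp: quotient_space_def)
  moreover have "v \<in> lcoset W v" using assms(2) by (simp add: mem_lcoset_iff csubspace_iff)
  ultimately show ?thesis by simp
qed

section \<open>The semidirect product as a normed space\<close>

lemmas semidirect_simps =
  zero_semidirect_def plus_semidirect_def minus_semidirect_def uminus_semidirect_def
  scaleC_semidirect_def

lemma bounded_linear_sd_fst: "bounded_linear sd_fst"
  by (rule bounded_linear_intro[where K = 1])
    (simp_all add: plus_semidirect_def scaleR_semidirect_def norm_semidirect_def)

lemma bounded_linear_sd_snd: "bounded_linear sd_snd"
  by (rule bounded_linear_intro[where K = 1])
    (simp_all add: plus_semidirect_def scaleR_semidirect_def norm_semidirect_def)

lemma bounded_linear_SD_fst: "bounded_linear (\<lambda>a. SD a 0)"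
  by (rule bounded_linear_intro[where K = 1])
    (simp_all add: plus_semidirect_def scaleR_semidirect_def norm_semidirect_def)

lemma bounded_linear_SD_snd: "bounded_linear (\<lambda>x. SD 0 x)"
  by (rule bounded_linear_intro[where K = 1])
    (simp_all add: plus_semidirect_def scaleR_semidirect_def norm_semidirect_def)

lemmas continuous_sd_fst = bounded_linear.continuous_on[OF bounded_linear_sd_fst]
lemmas continuous_sd_snd = bounded_linear.continuous_on[OF bounded_linear_sd_snd]
lemmas continuous_SD_fst = bounded_linear.continuous_on[OF bounded_linear_SD_fst]
lemmas continuous_SD_snd = bounded_linear.continuous_on[OF bounded_linear_SD_snd]

lemma continuous_SD:
  assumes "continuous_on S f" "continuous_on S g"
  shows "continuous_on S (\<lambda>p. SD (f p) (g p))"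
proof -
  have "continuous_on S (\<lambda>p. SD (f p) 0 + SD 0 (g p))"
    by (intro continuous_on_add continuous_SD_fst continuous_SD_snd assms)
  then show ?thesis by (simp add: plus_semidirect_def)
qed

lemma continuous_on_compose_UNIV:
  "continuous_on UNIV f \<Longrightarrow> continuous_on S g \<Longrightarrow> continuous_on S (\<lambda>x. f (g x))"
  by (rule continuous_on_compose2) auto

lemma continuous_clinear_bound:
  fixes f :: "'x::complex_banach \<Rightarrow> 'y::complex_banach"
  assumes "clinear f" "\<And>x. norm (f x) \<le> norm x * K"
  shows "continuous_on S f"
proof (rule linear_continuous_on)
  show "bounded_linear f"
    by (rule bounded_linear_intro[where K = K])
      (use assms in \<open>simp_all add: clinear_iff scaleR_scaleC\<close>)
qed

section \<open>Derivations with values in the ideal\<close>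

definition into_ideal ::
  "('a \<Rightarrow> 'u) \<times> ('u \<Rightarrow> 'u) \<Rightarrow> ('a, 'u) semidirect \<Rightarrow>
    ('a::complex_banach_algebra, 'u::complex_banach_algebra) semidirect"
  where "into_ideal v = (\<lambda>p. SD 0 (fst v (sd_fst p) + snd v (sd_snd p)))"

lemma clinear_into_ideal: "clinear into_ideal"
  by (simp add: clinear_iff into_ideal_def fun_eq_iff semidirect_simps scaleC_fun_def
      scaleC_prod_def scaleC_add_right scaleC_zero add_ac)

lemma csubspace_N1:
  assumes "\<And>b. clinear (l b)" "\<And>b. clinear (\<lambda>x. r x b)"
  shows "csubspace (N1 l r)"
proof -
  have "clinear (inner_der l r)"
    using assms by (simp add: clinear_iff inner_der_def fun_eq_iff scaleC_fun_def scaleC_diff)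
  then show ?thesis unfolding N1_def by (rule csubspace_range)
qed

lemma csubspace_Z1:
  fixes l :: "'b::complex_banach \<Rightarrow> 'x::complex_banach \<Rightarrow> 'x"
  assumes "\<And>b. clinear (l b)" "\<And>b. clinear (\<lambda>x. r x b)"
  shows "csubspace (Z1 m l r)"
proof -
  have lin: "l b 0 = 0" "r 0 b = 0" "l b (x + y) = l b x + l b y" "r (x + y) b = r x b + r y b"
    "l b (c *\<^sub>C x) = c *\<^sub>C l b x" "r (c *\<^sub>C x) b = c *\<^sub>C r x b" for b x y c
    using assms clinear_zero[OF assms(1)] clinear_zero[OF assms(2)] by (simp_all add: clinear_iff)
  have cont: "continuous_on UNIV (\<lambda>x. c *\<^sub>C f x)"
    if "continuous_on UNIV f" for c and f :: "'b \<Rightarrow> 'x"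
    by (rule continuous_on_compose_UNIV[OF continuous_clinear_bound[where K = "cmod c"] that])
      (simp_all add: clinear_iff scaleC_add_right scaleC_scaleC norm_scaleC mult.commute)
  show ?thesis
    unfolding csubspace_iff
  proof (intro conjI ballI allI)
    show "0 \<in> Z1 m l r"
      by (simp add: Z1_def derivation_def clinear_iff lin zero_fun_def scaleC_zero)
  next
    fix f g assume "f \<in> Z1 m l r" "g \<in> Z1 m l r"
    then show "f + g \<in> Z1 m l r"
      by (simp add: Z1_def derivation_def clinear_iff lin plus_fun_def scaleC_add_right
          continuous_on_add add_ac)
  next
    fix c f assume "f \<in> Z1 m l r"
    then show "c *\<^sub>C f \<in> Z1 m l r"
      by (simp add: Z1_def derivation_def clinear_iff lin scaleC_fun_def scaleC_add_right
          scaleC_scaleC mult.commute cont)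
  qed
qed

context compatible_banach_bimodule
begin

abbreviation mult :: "('a, 'u) semidirect \<Rightarrow> ('a, 'u) semidirect \<Rightarrow> ('a, 'u) semidirect"
  where "mult \<equiv> sd_mult lact ract"

lemma action_add:
  "lact (a + b) x = lact a x + lact b x" "lact a (x + y) = lact a x + lact a y"
  "ract (x + y) a = ract x a + ract y a" "ract x (a + b) = ract x a + ract x b"
  using clinear_lact_left clinear_lact_right clinear_ract_left clinear_ract_right
  by (simp_all add: clinear_iff)

lemma action_scale:
  "lact (c *\<^sub>C a) x = c *\<^sub>C lact a x" "lact a (c *\<^sub>C x) = c *\<^sub>C lact a x"
  "ract (c *\<^sub>C x) a = c *\<^sub>C ract x a" "ract x (c *\<^sub>C a) = c *\<^sub>C ract x a"
  using clinear_lact_left clinear_lact_right clinear_ract_left clinear_ract_right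
  by (simp_all add: clinear_iff)

lemma action_zero [simp]: "lact 0 x = 0" "lact a 0 = 0" "ract 0 a = 0" "ract x 0 = 0"
  using clinear_zero[OF clinear_lact_left] clinear_zero[OF clinear_lact_right]
    clinear_zero[OF clinear_ract_left] clinear_zero[OF clinear_ract_right]
  by simp_all

lemma clinear_mult_left: "clinear (\<lambda>p. mult p q)"
  by (simp add: clinear_iff sd_mult_def semidirect_simps action_add action_scale
      scaleC_add_right mult_scaleC_left distrib_right add_ac)

lemma clinear_mult_right: "clinear (mult p)"
  by (simp add: clinear_iff sd_mult_def semidirect_simps action_add action_scale
      scaleC_add_right mult_scaleC_right distrib_left add_ac)

lemma csubspace_N1_mult: "csubspace (N1 mult mult)"
  by (rule csubspace_N1[OF clinear_mult_right clinear_mult_left])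

lemma csubspace_Z1_mult: "csubspace (Z1 mult mult mult)"
  by (rule csubspace_Z1[OF clinear_mult_right clinear_mult_left])

lemma mult_assoc: "mult (mult p q) s = mult p (mult q s)"
  by (simp add: sd_mult_def action_add lact_mult ract_mult lact_ract lact_times ract_times
      ract_times_lact algebra_simps)

lemma continuous_lact: "continuous_on S (\<lambda>a. lact a x)" "continuous_on S' (lact a)"
proof -
  show "continuous_on S (\<lambda>a. lact a x)"
    by (rule continuous_clinear_bound[OF clinear_lact_left norm_lact])
  show "continuous_on S' (lact a)"
    by (rule continuous_clinear_bound[OF clinear_lact_right, where K = "norm a"])
      (metis norm_lact mult.commute)
qed

lemma continuous_ract: "continuous_on S (ract x)" "continuous_on S' (\<lambda>x. ract x a)"
proof -
  show "continuous_on S (ract x)"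
    by (rule continuous_clinear_bound[OF clinear_ract_right, where K = "norm x"])
      (metis norm_ract mult.commute)
  show "continuous_on S' (\<lambda>x. ract x a)"
    by (rule continuous_clinear_bound[OF clinear_ract_left norm_ract])
qed

lemma inner_der_mult:
  "inner_der mult mult (SD a x) = (\<lambda>p. SD (sd_fst p * a - a * sd_fst p)
     ((lact (sd_fst p) x - ract x (sd_fst p)) +
      ((ract (sd_snd p) a - lact a (sd_snd p)) + (sd_snd p * x - x * sd_snd p))))"
  by (simp add: inner_der_def fun_eq_iff sd_mult_def minus_semidirect_def)

lemma N1_subset_Z1: "N1 mult mult \<subseteq> Z1 mult mult mult"
proof
  fix D assume "D \<in> N1 mult mult"
  then obtain q where q: "D = inner_der mult mult q" unfolding N1_def by blast
  obtain a x where ax: "q = SD a x" by (cases q)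
  have "continuous_on UNIV D"
    unfolding q ax inner_der_mult
    by (intro continuous_intros continuous_SD continuous_sd_fst continuous_sd_snd
        continuous_on_compose_UNIV[OF continuous_lact(1)]
        continuous_on_compose_UNIV[OF continuous_lact(2)]
        continuous_on_compose_UNIV[OF continuous_ract(1)]
        continuous_on_compose_UNIV[OF continuous_ract(2)])
  moreover have "clinear D"
    using clinear_mult_left clinear_mult_right
    by (simp add: q inner_der_def clinear_iff scaleC_diff)
  moreover have "D (mult b c) = mult b (D c) + mult (D b) c" for b c
    by (simp add: q inner_der_def clinear_diff[OF clinear_mult_left]
        clinear_diff[OF clinear_mult_right] mult_assoc)
  ultimately show "D \<in> Z1 mult mult mult" by (simp add: Z1_def derivation_def)
qed

text \<open>Apply the product rule to \<open>(a, x)\<close> and \<open>(b, y)\<close>. Both sides are sums of terms in \<open>(a, b)\<close>,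
  \<open>(a, y)\<close>, \<open>(x, b)\<close> and \<open>(x, y)\<close>, which can be compared separately by setting the other two
  arguments to zero; each comparison gives one of the four conditions.\<close>

lemma derivation_into_ideal_iff:
  assumes "clinear \<delta>" "clinear \<tau>"
  shows "derivation mult mult mult (into_ideal (\<delta>, \<tau>)) \<longleftrightarrow>
     derivation (*) lact ract \<delta> \<and> derivation (*) (*) (*) \<tau> \<and>
     (\<forall>a y. \<tau> (lact a y) = lact a (\<tau> y) + \<delta> a * y) \<and>
     (\<forall>y a. \<tau> (ract y a) = y * \<delta> a + ract (\<tau> y) a)"
  (is "?L \<longleftrightarrow> ?R")
proof -
  have lin: "\<delta> 0 = 0" "\<tau> 0 = 0" "\<delta> (a + b) = \<delta> a + \<delta> b" "\<tau> (x + y) = \<tau> x + \<tau> y"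
    "\<delta> (c *\<^sub>C a) = c *\<^sub>C \<delta> a" "\<tau> (c *\<^sub>C x) = c *\<^sub>C \<tau> x" for a b x y c
    using assms clinear_zero[OF assms(1)] clinear_zero[OF assms(2)] by (simp_all add: clinear_iff)
  have clin: "clinear (into_ideal (\<delta>, \<tau>))"
    by (simp add: clinear_iff into_ideal_def semidirect_simps lin scaleC_add_right scaleC_zero
        add_ac)
  have "?L \<longleftrightarrow> (\<forall>a x b y. into_ideal (\<delta>, \<tau>) (mult (SD a x) (SD b y)) =
      mult (SD a x) (into_ideal (\<delta>, \<tau>) (SD b y)) + mult (into_ideal (\<delta>, \<tau>) (SD a x)) (SD b y))"
    unfolding derivation_def using clin by (metis semidirect.exhaust)
  also have "\<dots> \<longleftrightarrow> (\<forall>a x b y. \<delta> (a * b) + \<tau> (lact a y) + \<tau> (ract x b) + \<tau> (x * y) =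
      lact a (\<delta> b) + lact a (\<tau> y) + x * \<delta> b + x * \<tau> y +
      ract (\<delta> a) b + ract (\<tau> x) b + \<delta> a * y + \<tau> x * y)" (is "_ \<longleftrightarrow> ?M")
    by (simp add: into_ideal_def sd_mult_def semidirect_simps lin action_add algebra_simps)
  also have "?M \<longleftrightarrow> ?R"
  proof
    assume M: ?M
    have "\<delta> (a * b) = lact a (\<delta> b) + ract (\<delta> a) b" for a b
      using M[rule_format, of a b 0 0] by (simp add: lin)
    moreover have "\<tau> (x * y) = x * \<tau> y + \<tau> x * y" for x y
      using M[rule_format, of 0 0 y x] by (simp add: lin)
    moreover have "\<tau> (lact a y) = lact a (\<tau> y) + \<delta> a * y" for a y
      using M[rule_format, of a 0 y 0] by (simp add: lin)
    moreover have "\<tau> (ract x b) = x * \<delta> b + ract (\<tau> x) b" for x b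
      using M[rule_format, of 0 b 0 x] by (simp add: lin)
    ultimately show ?R using assms by (simp add: derivation_def)
  next
    assume ?R
    then show ?M by (simp add: derivation_def algebra_simps)
  qed
  finally show ?thesis .
qed

text \<open>This is where the hypothesis on the annihilator enters: it removes the products with values
  of \<open>\<delta>\<close> that keep \<open>\<tau>\<close> from being a bimodule homomorphism. Linearity of \<open>\<delta>\<close> and \<open>\<tau>\<close> has to be
  assumed, since \<open>into_ideal (\<delta>, \<tau>)\<close> does not change when a constant is added to \<open>\<delta>\<close> and
  subtracted from \<open>\<tau>\<close>.\<close>

lemma into_ideal_in_Z1_iff:
  assumes ann: "\<And>\<delta>. \<delta> \<in> Z1 (*) lact ract \<Longrightarrow> range \<delta> \<subseteq> ann"
    and "clinear \<delta>" "clinear \<tau>"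
  shows "into_ideal (\<delta>, \<tau>) \<in> Z1 mult mult mult \<longleftrightarrow>
    (\<delta>, \<tau>) \<in> Z1 (*) lact ract \<times> (bimodule_hom lact ract \<inter> Z1 (*) (*) (*))"
proof -
  have sd_snd_into_ideal:
    "(\<lambda>a. sd_snd (into_ideal (\<delta>, \<tau>) (SD a 0))) = \<delta>"
    "(\<lambda>x. sd_snd (into_ideal (\<delta>, \<tau>) (SD 0 x))) = \<tau>"
    using clinear_zero[OF assms(2)] clinear_zero[OF assms(3)]
    by (simp_all add: into_ideal_def)
  have cont: "continuous_on UNIV (into_ideal (\<delta>, \<tau>)) \<longleftrightarrow>
      continuous_on UNIV \<delta> \<and> continuous_on UNIV \<tau>"
  proof
    assume c: "continuous_on UNIV (into_ideal (\<delta>, \<tau>))"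
    have "continuous_on UNIV (\<lambda>a. sd_snd (into_ideal (\<delta>, \<tau>) (SD a 0)))"
      "continuous_on UNIV (\<lambda>x. sd_snd (into_ideal (\<delta>, \<tau>) (SD 0 x)))"
      by (rule continuous_sd_snd[OF continuous_on_compose_UNIV[OF c]],
          rule continuous_SD[OF continuous_on_id continuous_on_const]
            continuous_SD[OF continuous_on_const continuous_on_id])+
    then show "continuous_on UNIV \<delta> \<and> continuous_on UNIV \<tau>"
      unfolding sd_snd_into_ideal by blast
  next
    assume c: "continuous_on UNIV \<delta> \<and> continuous_on UNIV \<tau>"
    have "continuous_on UNIV (\<lambda>p :: ('a, 'u) semidirect. \<delta> (sd_fst p) + \<tau> (sd_snd p))"
      by (rule continuous_on_add;
          rule continuous_on_compose_UNIV[OF c[THEN conjunct1]]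
            continuous_on_compose_UNIV[OF c[THEN conjunct2]];
          rule continuous_sd_fst[OF continuous_on_id] continuous_sd_snd[OF continuous_on_id])
    then show "continuous_on UNIV (into_ideal (\<delta>, \<tau>))"
      unfolding into_ideal_def fst_conv snd_conv
      by (rule continuous_SD[OF continuous_on_const])
  qed
  have zero: "\<delta> a * y = 0" "y * \<delta> a = 0" if "\<delta> \<in> Z1 (*) lact ract" for a y
    using ann[OF that] by (auto simp: ann_def)
  show ?thesis
  proof
    assume "into_ideal (\<delta>, \<tau>) \<in> Z1 mult mult mult"
    then have d: "derivation mult mult mult (into_ideal (\<delta>, \<tau>))"
      and c: "continuous_on UNIV \<delta>" "continuous_on UNIV \<tau>"
      unfolding Z1_def using cont by blast+
    note der = derivation_into_ideal_iff[OF assms(2,3), THEN iffD1, OF d]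
    have \<delta>: "\<delta> \<in> Z1 (*) lact ract" using der c by (simp add: Z1_def)
    moreover have "\<tau> \<in> Z1 (*) (*) (*)" using der c by (simp add: Z1_def)
    moreover have "\<tau> \<in> bimodule_hom lact ract"
      using der c zero[OF \<delta>] assms(3) by (simp add: bimodule_hom_def)
    ultimately show "(\<delta>, \<tau>) \<in> Z1 (*) lact ract \<times> (bimodule_hom lact ract \<inter> Z1 (*) (*) (*))"
      by blast
  next
    assume "(\<delta>, \<tau>) \<in> Z1 (*) lact ract \<times> (bimodule_hom lact ract \<inter> Z1 (*) (*) (*))"
    then have \<delta>: "\<delta> \<in> Z1 (*) lact ract" and \<tau>: "\<tau> \<in> Z1 (*) (*) (*)"
      and hom: "\<tau> \<in> bimodule_hom lact ract"
      by blast+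
    have "derivation mult mult mult (into_ideal (\<delta>, \<tau>))"
      using \<delta> \<tau> hom zero[OF \<delta>]
      by (simp add: derivation_into_ideal_iff[OF assms(2,3)] Z1_def bimodule_hom_def)
    then show "into_ideal (\<delta>, \<tau>) \<in> Z1 mult mult mult"
      using \<delta> \<tau> cont by (simp add: Z1_def)
  qed
qed

lemma csubspace_clinear_pairs: "csubspace {(\<delta>, \<tau>). clinear \<delta> \<and> clinear \<tau>}"
  by (auto simp: csubspace_iff clinear_iff zero_prod_def plus_prod_def scaleC_prod_def
      scaleC_fun_def scaleC_add_right scaleC_scaleC scaleC_zero mult.commute add_ac)

lemma csubspace_numerator:
  assumes ann: "\<And>\<delta>. \<delta> \<in> Z1 (*) lact ract \<Longrightarrow> range \<delta> \<subseteq> ann"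
  shows "csubspace (Z1 (*) lact ract \<times> (bimodule_hom lact ract \<inter> Z1 (*) (*) (*)))"
    (is "csubspace ?V")
proof -
  have eq: "?V = {(\<delta>, \<tau>). clinear \<delta> \<and> clinear \<tau>} \<inter> into_ideal -` Z1 mult mult mult"
  proof (intro set_eqI)
    fix v :: "('a \<Rightarrow> 'u) \<times> ('u \<Rightarrow> 'u)"
    obtain \<delta> \<tau> where v: "v = (\<delta>, \<tau>)" by (cases v)
    have "v \<in> ?V \<Longrightarrow> clinear \<delta> \<and> clinear \<tau>" by (simp add: v Z1_def derivation_def)
    then show "v \<in> ?V \<longleftrightarrow>
        v \<in> {(\<delta>, \<tau>). clinear \<delta> \<and> clinear \<tau>} \<inter> into_ideal -` Z1 mult mult mult"
      using into_ideal_in_Z1_iff[OF ann, of \<delta> \<tau>]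
      by (simp only: v Int_iff mem_Collect_eq prod.case vimage_eq) metis
  qed
  show ?thesis
    unfolding eq by (intro csubspace_Int csubspace_clinear_pairs csubspace_vimage
        clinear_into_ideal csubspace_Z1_mult)
qed

text \<open>In one direction a pair in \<open>F\<close> with parameters \<open>x\<close> and \<open>a\<close> is sent to the inner derivation
  given by \<open>(a, x)\<close>; as this is a bounded derivation, the pair lies in \<open>V\<close> without a separate
  computation. In the other direction the components of an inner derivation are read off at
  \<open>(b, 0)\<close> and \<open>(0, y)\<close>.\<close>

lemma into_ideal_vimage_N1:
  assumes ann: "\<And>\<delta>. \<delta> \<in> Z1 (*) lact ract \<Longrightarrow> range \<delta> \<subseteq> ann"
  defines "V \<equiv> Z1 (*) lact ract \<times> (bimodule_hom lact ract \<inter> Z1 (*) (*) (*))"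
  shows "F_space lact ract = V \<inter> into_ideal -` N1 mult mult"
proof (intro subset_antisym subsetI)
  fix v assume "v \<in> F_space lact ract"
  then obtain x a where v: "v = (inner_der lact ract x,
      (\<lambda>y. ract y a - lact a y) + inner_der (*) (*) x)" and a: "inner_der (*) (*) a = 0"
    unfolding F_space_def by blast
  have "b * a - a * b = 0" for b
    using fun_cong[OF a, of b] by (simp add: inner_der_def)
  then have T: "into_ideal v = inner_der mult mult (SD a x)"
    unfolding inner_der_mult by (simp add: v into_ideal_def inner_der_def fun_eq_iff)
  then have N: "into_ideal v \<in> N1 mult mult" by (simp add: N1_def)
  have "clinear (fst v)" "clinear (snd v)"
    by (simp_all add: v inner_der_def clinear_iff action_add action_scale scaleC_diff
        scaleC_add_right mult_scaleC_left mult_scaleC_right algebra_simps)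
  then have "v \<in> V"
    using into_ideal_in_Z1_iff[OF ann, of "fst v" "snd v"] N N1_subset_Z1 by (auto simp: V_def)
  with N show "v \<in> V \<inter> into_ideal -` N1 mult mult" by simp
next
  fix v assume v: "v \<in> V \<inter> into_ideal -` N1 mult mult"
  obtain \<delta> \<tau> where dt: "v = (\<delta>, \<tau>)" by (cases v)
  have zero: "\<delta> 0 = 0" "\<tau> 0 = 0"
    using v clinear_zero unfolding dt V_def by (auto simp: Z1_def derivation_def)
  obtain q where "into_ideal v = inner_der mult mult q" using v by (auto simp: N1_def)
  then obtain a x where eq: "into_ideal v = inner_der mult mult (SD a x)" by (cases q) auto
  have eq': "into_ideal (\<delta>, \<tau>) p = inner_der mult mult (SD a x) p" for p
    using eq by (simp add: dt)
  have "b * a - a * b = 0" for b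
    using eq'[of "SD b 0"] unfolding inner_der_mult into_ideal_def by simp
  then have "inner_der (*) (*) a = 0" by (simp add: inner_der_def fun_eq_iff)
  moreover have "\<delta> b = lact b x - ract x b" for b
    using eq'[of "SD b 0"] unfolding inner_der_mult into_ideal_def by (simp add: zero)
  then have "\<delta> = inner_der lact ract x" by (simp add: inner_der_def fun_eq_iff)
  moreover have "\<tau> y = (ract y a - lact a y) + (y * x - x * y)" for y
    using eq'[of "SD 0 y"] unfolding inner_der_mult into_ideal_def by (simp add: zero)
  then have "\<tau> = (\<lambda>y. ract y a - lact a y) + inner_der (*) (*) x"
    by (simp add: inner_der_def fun_eq_iff)
  ultimately show "v \<in> F_space lact ract" unfolding F_space_def dt by blast
qed

text \<open>The part of a derivation that maps \<open>A\<close> to \<open>A\<close> is a derivation of \<open>A\<close>, hence inner by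
  hypothesis, and an inner derivation of the semidirect product removes it.\<close>

lemma Z1_eq_into_ideal_mod_N1:
  assumes ideal: "\<And>x. sd_fst (D (SD 0 x)) = 0"
    and inner: "Z1 (*) (*) ((*) :: 'a \<Rightarrow> 'a \<Rightarrow> 'a) \<subseteq> N1 (*) (*)"
    and D: "D \<in> Z1 mult mult mult"
  shows "\<exists>\<delta> \<tau>. clinear \<delta> \<and> clinear \<tau> \<and> into_ideal (\<delta>, \<tau>) - D \<in> N1 mult mult"
proof -
  have lin: "D (p + q) = D p + D q" "D (c *\<^sub>C p) = c *\<^sub>C D p"
    and der: "D (mult p q) = mult p (D q) + mult (D p) q"
    and cont: "continuous_on UNIV D" for p q c
    using D by (auto simp: Z1_def derivation_def clinear_iff)
  define d where "d a = sd_fst (D (SD a 0))" for a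
  have fst_add: "sd_fst (p + q) = sd_fst p + sd_fst q"
    and snd_add: "sd_snd (p + q) = sd_snd p + sd_snd q"
    and fst_scale: "sd_fst (c *\<^sub>C p) = c *\<^sub>C sd_fst p"
    and snd_scale: "sd_snd (c *\<^sub>C p) = c *\<^sub>C sd_snd p" for p q :: "('a, 'u) semidirect" and c
    by (simp_all add: semidirect_simps)
  have SD_simps: "SD (a + b) 0 = SD a 0 + SD b 0" "SD 0 (x + y) = SD 0 x + SD 0 y"
    "SD (c *\<^sub>C a) 0 = c *\<^sub>C SD a 0" "SD 0 (c *\<^sub>C x) = c *\<^sub>C SD 0 x"
    for a b :: 'a and x y :: 'u and c
    by (simp_all add: semidirect_simps scaleC_zero)
  have D_SD: "D (SD a x) = D (SD a 0) + D (SD 0 x)" for a x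
    using lin(1)[of "SD a 0" "SD 0 x"] by (simp add: plus_semidirect_def)
  have "d \<in> Z1 (*) (*) (*)"
  proof -
    have "continuous_on UNIV d"
      unfolding d_def by (intro continuous_sd_fst continuous_on_compose_UNIV[OF cont]
          continuous_SD continuous_intros)
    moreover have "clinear d"
      by (simp add: clinear_iff d_def SD_simps lin fst_add fst_scale)
    moreover have "d (a * b) = a * d b + d a * b" for a b
      using der[of "SD a 0" "SD b 0"] by (simp add: d_def sd_mult_def plus_semidirect_def)
    ultimately show ?thesis by (simp add: Z1_def derivation_def)
  qed
  then obtain a where a: "d = inner_der (*) (*) a"
    using inner unfolding N1_def by blast
  \<comment> \<open>The inner derivation given by \<open>(a, 0)\<close> has \<open>d\<close> as its component from \<open>A\<close> to \<open>A\<close>, so \<open>E\<close> takes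
    values in the ideal.\<close>
  define E where "E = D - inner_der mult mult (SD a 0)"
  define \<delta> where "\<delta> b = sd_snd (E (SD b 0))" for b
  define \<tau> where "\<tau> y = sd_snd (E (SD 0 y))" for y
  have E_lin: "E (p + q) = E p + E q" "E (c *\<^sub>C p) = c *\<^sub>C E p" for p q c
    using clinear_mult_left clinear_mult_right
    by (simp_all add: E_def lin inner_der_def clinear_iff scaleC_diff)
  have E_fst: "sd_fst (E p) = 0" for p
  proof (cases p)
    case (SD b y)
    have "sd_fst (D (SD b y)) = d b"
      by (subst D_SD) (simp add: fst_add ideal d_def)
    then show ?thesis
      by (simp add: SD a E_def inner_der_mult minus_semidirect_def) (simp add: inner_der_def)
  qed
  have "E p = into_ideal (\<delta>, \<tau>) p" for p
  proof (cases p)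
    case (SD b y)
    have "E (SD b y) = E (SD b 0) + E (SD 0 y)"
      using E_lin(1)[of "SD b 0" "SD 0 y"] by (simp add: plus_semidirect_def)
    then show ?thesis
      by (intro semidirect.expand) (simp add: SD into_ideal_def \<delta>_def \<tau>_def E_fst fst_add snd_add)
  qed
  then have "into_ideal (\<delta>, \<tau>) = E" by (simp add: fun_eq_iff)
  then have "into_ideal (\<delta>, \<tau>) - D = 0 - inner_der mult mult (SD a 0)"
    by (simp add: E_def)
  moreover have "0 - inner_der mult mult (SD a 0) \<in> N1 mult mult"
  proof (rule csubspace_diff[OF csubspace_N1_mult])
    show "0 \<in> N1 mult mult" using csubspace_N1_mult unfolding csubspace_iff by blast
  qed (simp add: N1_def)
  moreover have "clinear \<delta>" "clinear \<tau>"
    by (simp_all add: clinear_iff \<delta>_def \<tau>_def SD_simps E_lin snd_add snd_scale)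
  ultimately show ?thesis by metis
qed

end

theorem theorem4p4:
  fixes lact :: "'a::complex_banach_algebra \<Rightarrow> 'u::complex_banach_algebra \<Rightarrow> 'u"
    and ract :: "'u \<Rightarrow> 'a \<Rightarrow> 'u"
  defines "m \<equiv> sd_mult lact ract"
    and "V \<equiv> Z1 (*) lact ract \<times> (bimodule_hom lact ract \<inter> Z1 (*) (*) (*))"
  assumes "compatible_banach_bimodule lact ract"
    and "\<And>D. derivation m m m D \<Longrightarrow> D ` {SD 0 x | x. True} \<subseteq> {SD 0 x | x. True}"
    and "\<And>\<delta>. \<delta> \<in> Z1 (*) lact ract \<Longrightarrow> range \<delta> \<subseteq> ann"
    and "vcarrier (H1 (*) (*) ((*) :: 'a \<Rightarrow> 'a \<Rightarrow> 'a)) = {vzero (H1 (*) (*) (*))}"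
  shows "F_space lact ract \<subseteq> V \<and> csubspace (F_space lact ract) \<and>
    H1 m m m \<cong>\<^sub>C quotient_space V (F_space lact ract)"
proof -
  interpret compatible_banach_bimodule lact ract by fact
  note ann = assms(5)
  have F: "F_space lact ract = V \<inter> into_ideal -` N1 m m"
    unfolding V_def m_def by (rule into_ideal_vimage_N1[OF ann])
  have V: "csubspace V" unfolding V_def by (rule csubspace_numerator[OF ann])
  have N: "csubspace (N1 m m)"
    unfolding m_def by (rule csubspace_N1_mult)
  have "csubspace (N1 (*) ((*) :: 'a \<Rightarrow> 'a \<Rightarrow> 'a))"
    by (rule csubspace_N1)
      (simp_all add: clinear_iff distrib_left distrib_right mult_scaleC_left mult_scaleC_right)
  then have inner: "Z1 (*) (*) ((*) :: 'a \<Rightarrow> 'a \<Rightarrow> 'a) \<subseteq> N1 (*) (*)"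
    using quotient_space_trivialD[OF assms(6)[unfolded H1_def]] by blast
  have V_iff: "into_ideal (\<delta>, \<tau>) \<in> Z1 m m m \<longleftrightarrow> (\<delta>, \<tau>) \<in> V" if "clinear \<delta>" "clinear \<tau>" for \<delta> \<tau>
    unfolding V_def m_def by (rule into_ideal_in_Z1_iff[OF ann that])
  have into: "into_ideal v \<in> Z1 m m m" if "v \<in> V" for v
    using that V_iff[of "fst v" "snd v"] by (auto simp: V_def Z1_def derivation_def)
  have onto: "\<exists>v\<in>V. into_ideal v - D \<in> N1 m m" if D: "D \<in> Z1 m m m" for D
  proof -
    have "sd_fst (D (SD 0 x)) = 0" for x
    proof -
      have "D (SD 0 x) \<in> {SD 0 x | x. True}"
        using assms(4)[of D] D unfolding Z1_def by blast
      then show ?thesis by auto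
    qed
    then obtain \<delta> \<tau> where lin: "clinear \<delta>" "clinear \<tau>" and N1: "into_ideal (\<delta>, \<tau>) - D \<in> N1 m m"
      using Z1_eq_into_ideal_mod_N1[OF _ inner D[unfolded m_def]] unfolding m_def by blast
    have Z: "csubspace (Z1 m m m)"
      unfolding m_def by (rule csubspace_Z1_mult)
    have "(into_ideal (\<delta>, \<tau>) - D) + D \<in> Z1 m m m"
      using Z N1 D N1_subset_Z1 unfolding csubspace_iff m_def by blast
    then have "(\<delta>, \<tau>) \<in> V" using V_iff[OF lin] by simp
    with N1 show ?thesis by blast
  qed
  have "H1 m m m \<cong>\<^sub>C quotient_space V (F_space lact ract)"
    unfolding H1_def F by (rule quotient_space_iso_vimage[OF clinear_into_ideal V N into onto])
  moreover have "csubspace (F_space lact ract)"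
    unfolding F by (rule csubspace_Int[OF V csubspace_vimage[OF clinear_into_ideal N]])
  ultimately show ?thesis using F by blast
qed

end
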